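(* There exists a measure preserving system $(X,\mathcal{X},\mu,T_1,T_2,T_3)$ with three commuting transformations $T_1$, $T_2$, $T_3$ (i.e. $T_iT_j=T_jT_i$ for all $i,j$), ergodic for $\langle T_1,T_2,T_3\rangle$, such that for every real number $\ell>0$ there exists a set $A\in\mathcal{X}$ such that $$\mu(A\cap T_1^{-n}A\cap T_2^{-n}A\cap T_3^{-n}A)<\mu(A)^{\ell}\quad\text{for every integer } n\neq 0.$$
   Context: A measure preserving system is a tuple $(X,\mathcal{X},\mu,T_1,\ldots,T_d)$, where $(X,\mathcal{X},\mu)$ is a probability space and $T_1,\ldots,T_d\colon X\to X$ are (invertible, bimeasurable) maps such that for all $A\in\mathcal{X}$ and $1\le i\le d$, $T_i^{-1}A\in\mathcal{X}$ and $\mu(T_i^{-1}A)=\mu(A)$. $\langle T_1,\ldots,T_d\rangle$ denotes the group generated by $T_1,\ldots,T_d$. The system is ergodic for $\langle T_1,\ldots,T_d\rangle$ if, whenever $A\in\mathcal{X}$ satisfies $T_i^{-1}A=A$ for all $1\le i\le d$, one has $\mu(A)=0$ or $1$. The single system works for all $\ell$; the set $A$ may depend on $\ell$ but not on $n$. *)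

theory Defs
  imports "HOL-Probability.Probability"
begin

text \<open>
  Transformations are total HOL functions of which only the restriction to
  \<^term>\<open>space M\<close> matters; preimages are therefore always intersected with
  \<^term>\<open>space M\<close>. A system \<open>(X, \<X>, \<mu>, T\<^sub>1, \<dots>, T\<^sub>d)\<close> is
  a measure together with the list of its transformations.
\<close>

definition pre_image :: "'a measure \<Rightarrow> ('a \<Rightarrow> 'a) \<Rightarrow> 'a set \<Rightarrow> 'a set" where
  "pre_image M T A = T -` A \<inter> space M"

definition measure_preserving_system :: "'a measure \<Rightarrow> ('a \<Rightarrow> 'a) list \<Rightarrow> bool" where
  "measure_preserving_system M Ts \<longleftrightarrow>
     prob_space M \<and>
     (\<forall>T\<in>set Ts.
        bij_betw T (space M) (space M) \<and>
        T \<in> measurable M M \<and>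
        inv_into (space M) T \<in> measurable M M \<and>
        (\<forall>A\<in>sets M. measure M (pre_image M T A) = measure M A))"

definition commuting_system :: "'a measure \<Rightarrow> ('a \<Rightarrow> 'a) list \<Rightarrow> bool" where
  "commuting_system M Ts \<longleftrightarrow>
     (\<forall>S\<in>set Ts. \<forall>T\<in>set Ts. \<forall>x\<in>space M. S (T x) = T (S x))"

definition ergodic_system :: "'a measure \<Rightarrow> ('a \<Rightarrow> 'a) list \<Rightarrow> bool" where
  "ergodic_system M Ts \<longleftrightarrow>
     (\<forall>A\<in>sets M. (\<forall>T\<in>set Ts. pre_image M T A = A) \<longrightarrow> measure M A = 0 \<or> measure M A = 1)"

definition int_iterate :: "'a measure \<Rightarrow> ('a \<Rightarrow> 'a) \<Rightarrow> int \<Rightarrow> 'a \<Rightarrow> 'a" where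
  "int_iterate M T n =
     (if n \<ge> 0 then T ^^ nat n else inv_into (space M) T ^^ nat (- n))"

end

theory Submission
  imports Defs
begin

text \<open>
  The construction separates ergodicity from the failure of recurrence. On the torus the map
  \<open>S (x, y) = (x, y + x)\<close> preserves Lebesgue measure and each fibre of the first coordinate; the
  points \<open>y, S\<^sup>n y, S\<^sup>2\<^sup>n y\<close> of a fibre form a three-term progression of difference \<open>n x\<close>, and for
  every \<open>n \<noteq> 0\<close> this difference is equidistributed. Sets with few three-term progressions
  therefore recur badly under \<open>S\<close> and \<open>S\<^sup>2\<close>. Although \<open>S\<close> is not ergodic, it acts coordinatewise on
  the space of two-sided sequences of points of the torus with the product measure, and there it
  commutes with the shift, which is ergodic. The system consists of the shift \<open>T\<^sub>1\<close>, the
  coordinatewise action \<open>T\<^sub>2\<close> of \<open>S\<close>, and \<open>T\<^sub>3 = T\<^sub>2\<^sup>2\<close>.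

  Ergodicity (\<open>bernoulli_shift_zero_one\<close>) follows from mixing: distant translates of cylinders are
  independent, and this passes to all measurable sets (\<open>mixing_from_generator\<close>).

  The sets are continuous versions of Behrend's. Sequences offer arbitrarily many independent
  coordinates, so that spheres of high dimension are available inside the system itself: let \<open>A\<close> restrict the second
  components \<open>y\<^sub>1, \<dots>, y\<^sub>d\<close> of \<open>d\<close> coordinates to a thin spherical shell of width \<open>\<eta>\<^sup>2\<close> in the squared
  radius inside \<open>[0, 1/2)\<^sup>d\<close>. By the parallelogram law a progression in the shell has difference
  less than \<open>\<eta>\<close> in each coordinate (\<open>progression_in_shell\<close>), so the return set has measure at most
  \<open>(4 \<eta>)\<^sup>d\<close>, uniformly in \<open>n\<close> (\<open>measure_shell_progression\<close>). About \<open>d / (4 \<eta>\<^sup>2)\<close> shells fill the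
  cube, so some shell has measure of order \<open>\<eta>\<^sup>2\<close> for fixed \<open>d\<close> (\<open>exists_heavy_shell\<close>). Choosing
  \<open>d > 2 l\<close> and then \<open>\<eta>\<close> small makes the return set smaller than \<open>\<mu>(A)\<close> to the power \<open>l\<close>.

  Finally the space of sequences has the cardinality of the continuum, and a system can be carried
  along any injection of the underlying points.
\<close>

section \<open>Ergodicity of Bernoulli shifts\<close>

text \<open>
  For fixed \<open>n\<close> both sides are additive in \<open>B\<close>, and \<open>\<mu>(f\<^sub>n\<^sup>-\<^sup>1 B \<inter> D) \<le> \<mu>(B)\<close> because \<open>f\<^sub>n\<close>
  preserves the measure. This bound is uniform in \<open>n\<close>, so limits may be exchanged with countable
  disjoint unions (Tannery), and the sets \<open>B\<close> with the mixing property form a Dynkin system.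
\<close>
lemma (in prob_space) mixing_from_generator:
  fixes f :: "nat \<Rightarrow> 'a \<Rightarrow> 'a"
  assumes G: "Int_stable G" "G \<subseteq> Pow (space M)" "sets M = sigma_sets (space M) G"
    and f: "\<And>n. f n \<in> measurable M M" "\<And>n. distr M M (f n) = M"
    and D: "D \<in> events"
    and lim: "\<And>B. B \<in> G \<Longrightarrow> (\<lambda>n. prob (f n -` B \<inter> D)) \<longlonglongrightarrow> prob B * prob D"
    and B: "B \<in> events"
  shows "(\<lambda>n. prob (f n -` B \<inter> D)) \<longlonglongrightarrow> prob B * prob D"
proof -
  have Dsp: "D \<subseteq> space M" using D sets.sets_into_space by auto
  have meas: "f n -` X \<inter> D \<in> events" if "X \<in> events" for n X
  proof -
    have "f n -` X \<inter> D = (f n -` X \<inter> space M) \<inter> D" using Dsp by auto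
    then show ?thesis using measurable_sets[OF f(1) that] D by auto
  qed
  have dom: "prob (f n -` X \<inter> D) \<le> prob X" if "X \<in> events" for n X
  proof -
    have "prob X = measure (distr M M (f n)) X" by (simp add: f(2))
    also have "\<dots> = prob (f n -` X \<inter> space M)"
      using f(1) that by (simp add: measure_distr)
    finally show ?thesis using Dsp that f(1)
      by (auto intro!: finite_measure_mono measurable_sets)
  qed
  from G(1,2) B[unfolded G(3)] show ?thesis
  proof (induction rule: sigma_sets_induct_disjoint)
    case (basic A) then show ?case by (rule lim)
  next
    case empty show ?case by simp
  next
    case (compl A)
    then have A: "A \<in> events" by (simp add: G(3))
    have "prob (f n -` (space M - A) \<inter> D) = prob D - prob (f n -` A \<inter> D)" for n
    proof -
      have "f n -` (space M - A) \<inter> D = D - (f n -` A \<inter> D)"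
        using Dsp measurable_space[OF f(1)] by auto
      then show ?thesis using finite_measure_Diff[OF D meas[OF A, of n]] by simp
    qed
    moreover have "(\<lambda>n. prob D - prob (f n -` A \<inter> D)) \<longlonglongrightarrow> prob D - prob A * prob D"
      by (intro tendsto_intros compl)
    ultimately show ?case
      by (simp only: prob_compl[OF A] left_diff_distrib mult_1_left)
  next
    case (union A)
    then have A: "A i \<in> events" for i by (auto simp: G(3))
    have "(\<lambda>i. prob (A i)) sums prob (\<Union>i. A i)"
      using A union(1) by (intro finite_measure_UNION) auto
    note sumA = this
    have sumf: "(\<lambda>i. prob (f n -` A i \<inter> D)) sums prob (f n -` (\<Union>i. A i) \<inter> D)" for n
    proof -
      have "(\<lambda>i. prob (f n -` A i \<inter> D)) sums prob (\<Union>i. f n -` A i \<inter> D)"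
        using meas[OF A] union(1)
        by (intro finite_measure_UNION) (auto simp: disjoint_family_on_def disjoint_iff)
      moreover have "(\<Union>i. f n -` A i \<inter> D) = f n -` (\<Union>i. A i) \<inter> D" by auto
      ultimately show ?thesis by simp
    qed
    have "(\<lambda>n. \<Sum>i. prob (f n -` A i \<inter> D)) \<longlonglongrightarrow> (\<Sum>i. prob (A i) * prob D)"
      using tannerys_theorem[where F = sequentially and a = "\<lambda>i n. prob (f n -` A i \<inter> D)"
          and M = "\<lambda>i. prob (A i)" and b = "\<lambda>i. prob (A i) * prob D"]
      using union(3) dom[OF A] sums_summable[OF sumA]
      by (auto intro!: always_eventually)
    moreover have "(\<Sum>i. prob (A i) * prob D) = prob (\<Union>i. A i) * prob D"
      using sums_mult2[OF sumA] by (rule sums_unique[symmetric])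
    ultimately show ?case using sums_unique[OF sumf] by simp
  qed
qed

definition shift :: "int \<Rightarrow> (int \<Rightarrow> 'a) \<Rightarrow> int \<Rightarrow> 'a" where
  "shift n \<omega> i = \<omega> (i + n)"

abbreviation bernoulli :: "'a measure \<Rightarrow> (int \<Rightarrow> 'a) measure" where
  "bernoulli N \<equiv> PiM UNIV (\<lambda>_. N)"

lemma shift_measurable: "shift n \<in> measurable (bernoulli N) (bernoulli N)"
proof -
  have "(\<lambda>\<omega> i. \<omega> (i + n)) \<in> measurable (bernoulli N) (bernoulli N)"
    by (rule measurable_PiM_single') (auto simp: space_PiM)
  then show ?thesis by (simp add: shift_def[abs_def])
qed

lemma distr_shift:
  assumes "prob_space N"
  shows "distr (bernoulli N) (bernoulli N) (shift n) = bernoulli N"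
  using distr_PiM_reindex[of UNIV "\<lambda>_. N" "\<lambda>i. i + n" UNIV] assms
  by (simp add: inj_def shift_def[abs_def] restrict_UNIV)

text \<open>
  Translating a cylinder over \<open>J\<close> yields a cylinder over \<open>J + n\<close>. Once \<open>J + n\<close> misses \<open>K\<close>, the
  two cylinders constrain different coordinates, and their intersection is a single cylinder over
  \<open>J + n \<union> K\<close> whose measure is a product over both index sets.
\<close>
lemma shift_cylinders_independent:
  assumes N: "prob_space N" and J: "finite J" "finite K"
    and E: "\<And>j. j \<in> J \<Longrightarrow> E j \<in> sets N" "\<And>k. k \<in> K \<Longrightarrow> F k \<in> sets N"
    and disj: "(\<lambda>j. j + n) ` J \<inter> K = {}"
  defines "P \<equiv> bernoulli N"
  defines "B \<equiv> prod_emb UNIV (\<lambda>_. N) J (Pi\<^sub>E J E)"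
    and "C \<equiv> prod_emb UNIV (\<lambda>_. N) K (Pi\<^sub>E K F)"
  shows "measure P (shift n -` B \<inter> C) = measure P B * measure P C"
proof -
  interpret product_prob_space "\<lambda>_. N" "UNIV :: int set"
    using N by (intro product_prob_spaceI)
  define H where "H i = (if i \<in> K then F i else E (i - n))" for i
  let ?L = "(\<lambda>j. j + n) ` J"
  have HE: "H (j + n) = E j" if "j \<in> J" for j using that disj by (auto simp: H_def)
  have HF: "H k = F k" if "k \<in> K" for k using that by (simp add: H_def)
  have eq: "shift n -` B \<inter> C = prod_emb UNIV (\<lambda>_. N) (?L \<union> K) (Pi\<^sub>E (?L \<union> K) H)" (is "?l = ?r")
  proof (rule set_eqI)
    fix \<omega>
    have "\<omega> \<in> ?l \<longleftrightarrow> (\<forall>i. \<omega> i \<in> space N) \<and> (\<forall>j\<in>J. \<omega> (j + n) \<in> E j) \<and> (\<forall>k\<in>K. \<omega> k \<in> F k)"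
      unfolding B_def C_def by (auto simp: prod_emb_iff shift_def restrict_PiE_iff)
    also have "\<dots> \<longleftrightarrow> \<omega> \<in> ?r"
      by (simp add: prod_emb_iff restrict_PiE_iff Pi_iff ball_Un HE HF) blast
    finally show "\<omega> \<in> ?l \<longleftrightarrow> \<omega> \<in> ?r" .
  qed
  have "measure P (shift n -` B \<inter> C) = (\<Prod>i\<in>?L \<union> K. measure N (H i))"
    unfolding eq P_def using J E disj
    by (intro measure_PiM_emb) (auto simp: H_def)
  also have "\<dots> = (\<Prod>i\<in>?L. measure N (H i)) * (\<Prod>i\<in>K. measure N (H i))"
    using J disj by (intro prod.union_disjoint) auto
  also have "(\<Prod>i\<in>?L. measure N (H i)) = (\<Prod>j\<in>J. measure N (E j))"
    by (subst prod.reindex) (auto simp: inj_on_def HE)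
  also have "(\<Prod>i\<in>K. measure N (H i)) = (\<Prod>i\<in>K. measure N (F i))"
    by (auto simp: H_def)
  finally show ?thesis
    unfolding P_def B_def C_def using J E by (simp add: measure_PiM_emb)
qed

text \<open>
  Mixing is extended from cylinders to all sets in one argument at a time. For invariant \<open>A\<close> and a
  cylinder \<open>C\<close> the measure of \<open>\<sigma>\<^sup>-\<^sup>n A \<inter> C\<close> does not depend on \<open>n\<close>, so mixing in the first argument
  gives \<open>\<mu>(A \<inter> C) = \<mu>(A) \<mu>(C)\<close>. Extending in \<open>C\<close> allows \<open>C = A\<close>, and then
  \<open>\<mu>(A) = \<mu>(A)\<^sup>2\<close>.
\<close>
lemma bernoulli_shift_zero_one:
  assumes N: "prob_space N" and A: "A \<in> sets (bernoulli N)"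
    and inv: "pre_image (bernoulli N) (shift 1) A = A"
  shows "measure (bernoulli N) A = 0 \<or> measure (bernoulli N) A = 1"
proof -
  interpret product_prob_space "\<lambda>_. N" "UNIV :: int set"
    using N by (intro product_prob_spaceI)
  let ?P = "bernoulli N" and ?G = "prod_algebra UNIV (\<lambda>_::int. N)"
  have gen: "Int_stable ?G" "?G \<subseteq> Pow (space ?P)" "sets ?P = sigma_sets (space ?P) ?G"
    using prod_algebra_sets_into_space[of UNIV "\<lambda>_::int. N"]
    by (auto simp: Int_stable_prod_algebra sets_PiM space_PiM)
  have Asp: "A \<subseteq> space ?P" using A sets.sets_into_space by auto
  have sinv: "shift (int n) \<omega> \<in> A \<longleftrightarrow> \<omega> \<in> A" if "\<omega> \<in> space ?P" for n \<omega>
    using that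
  proof (induction n)
    case 0 then show ?case by (simp add: shift_def[abs_def])
  next
    case (Suc n)
    let ?\<eta> = "shift (int n) \<omega>"
    have "shift (int (Suc n)) \<omega> = shift 1 ?\<eta>"
      by (auto simp: shift_def fun_eq_iff algebra_simps)
    moreover have "?\<eta> \<in> space ?P"
      using measurable_space[OF shift_measurable Suc.prems] .
    then have "shift 1 ?\<eta> \<in> A \<longleftrightarrow> ?\<eta> \<in> A"
      using inv unfolding pre_image_def by blast
    ultimately show ?case using Suc by simp
  qed
  have step: "prob (C \<inter> A) = prob C * prob A" if CG: "C \<in> ?G" for C
  proof -
    obtain K F where C: "C = prod_emb UNIV (\<lambda>_. N) K (Pi\<^sub>E K F)"
      and K: "finite K" "\<And>k. k \<in> K \<Longrightarrow> F k \<in> sets N"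
      using CG by (auto elim!: prod_algebraE)
    have Cs: "C \<in> sets ?P" using CG gen(3) by auto
    have "(\<lambda>n. prob (shift (int n) -` A \<inter> C)) \<longlonglongrightarrow> prob A * prob C"
    proof (rule mixing_from_generator[OF gen _ _ Cs _ A])
      fix B assume "B \<in> ?G"
      then obtain J E where B: "B = prod_emb UNIV (\<lambda>_. N) J (Pi\<^sub>E J E)"
        and J: "finite J" "\<And>j. j \<in> J \<Longrightarrow> E j \<in> sets N"
        by (auto elim!: prod_algebraE)
      \<comment> \<open>Translating by \<open>m\<close> or more puts \<open>J\<close> entirely to the right of \<open>K\<close>; the inserted \<open>0\<close>
          gives \<open>Max\<close> and \<open>Min\<close> a meaning when \<open>J\<close> or \<open>K\<close> is empty.\<close>
      define m where "m = nat (Max (insert 0 K) - Min (insert 0 J) + 1)"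
      have disj: "(\<lambda>j. j + int n) ` J \<inter> K = {}" if "n \<ge> m" for n
      proof -
        have "k < j + int n" if "j \<in> J" "k \<in> K" for j k
        proof -
          have "k \<le> Max (insert 0 K)" "Min (insert 0 J) \<le> j" using J K that by auto
          then show ?thesis using \<open>n \<ge> m\<close> unfolding m_def by linarith
        qed
        then show ?thesis by fastforce
      qed
      have "\<forall>\<^sub>F n in sequentially. prob (shift (int n) -` B \<inter> C) = prob B * prob C"
        unfolding B C using shift_cylinders_independent[OF N J(1) K(1) J(2) K(2) disj]
        by (intro eventually_sequentiallyI[of m]) auto
      then show "(\<lambda>n. prob (shift (int n) -` B \<inter> C)) \<longlonglongrightarrow> prob B * prob C"
        by (rule tendsto_eventually)
    qed (auto simp: shift_measurable distr_shift N)
    moreover have "shift (int n) -` A \<inter> C = A \<inter> C" for n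
      using sinv sets.sets_into_space[OF Cs] by blast
    ultimately show ?thesis by (simp add: LIMSEQ_const_iff Int_commute mult.commute)
  qed
  \<comment> \<open>The same extension lemma with the identity in place of the shifts turns independence of \<open>A\<close>
      from cylinders into independence of \<open>A\<close> from itself.\<close>
  have "(\<lambda>n::nat. prob ((\<lambda>\<omega>. \<omega>) -` A \<inter> A)) \<longlonglongrightarrow> prob A * prob A"
    by (rule mixing_from_generator[OF gen _ _ A _ A])
      (auto simp: step distr_id[unfolded id_def])
  then have "prob A = prob A * prob A" by (simp add: LIMSEQ_const_iff)
  then show ?thesis by auto
qed

section \<open>Measure preserving actions of the integers\<close>

text \<open>
  An action of \<open>\<int>\<close> given with all its powers at once. A transformation \<open>R k\<close> belonging to such a
  family has \<open>R (- k)\<close> as inverse and \<open>R (k * n)\<close> as its \<open>n\<close>-th iterate, which replaces inverses and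
  iterates of functions by explicit formulas. The laws are required only on the space of the measure.
\<close>
locale measure_preserving_flow = prob_space M for M :: "'a measure" +
  fixes R :: "int \<Rightarrow> 'a \<Rightarrow> 'a"
  assumes flow_measurable: "R n \<in> measurable M M"
    and distr_flow: "distr M M (R n) = M"
    and flow_0: "x \<in> space M \<Longrightarrow> R 0 x = x"
    and flow_add: "x \<in> space M \<Longrightarrow> R m (R n x) = R (m + n) x"
begin

lemma flow_space: "x \<in> space M \<Longrightarrow> R n x \<in> space M"
  using measurable_space[OF flow_measurable] .

lemma bij_betw_flow: "bij_betw (R n) (space M) (space M)"
  by (rule bij_betw_byWitness[where f' = "R (- n)"]) (auto simp: flow_space flow_add flow_0)

lemma inv_into_flow:
  assumes "x \<in> space M"
  shows "inv_into (space M) (R n) x = R (- n) x"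
proof (rule inv_into_f_eq)
  show "inj_on (R n) (space M)" using bij_betw_flow by (rule bij_betw_imp_inj_on)
qed (use assms in \<open>auto simp: flow_space flow_add flow_0\<close>)

lemma measure_pre_image_flow: "A \<in> events \<Longrightarrow> prob (pre_image M (R n) A) = prob A"
  using measure_distr[OF flow_measurable, of A n] by (simp add: distr_flow pre_image_def)

lemma int_iterate_flow:
  assumes "x \<in> space M"
  shows "int_iterate M (R k) n x = R (k * n) x"
proof -
  have pow: "(R k ^^ j) x = R (k * int j) x" for k j
    by (induction j) (use assms in \<open>auto simp: flow_0 flow_add algebra_simps\<close>)
  have inv: "(inv_into (space M) (R k) ^^ j) x = (R (- k) ^^ j) x" for j
  proof (induction j)
    case (Suc j)
    then show ?case using assms by (simp add: pow inv_into_flow flow_space)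
  qed simp
  show ?thesis
    unfolding int_iterate_def by (simp add: inv pow)
qed

end

lemma measure_preserving_systemI:
  assumes "prob_space M" and "\<And>T. T \<in> set Ts \<Longrightarrow> \<exists>R n. measure_preserving_flow M R \<and> T = R n"
  shows "measure_preserving_system M Ts"
  unfolding measure_preserving_system_def
proof (intro conjI ballI assms(1))
  fix T assume "T \<in> set Ts"
  then obtain R n where "measure_preserving_flow M R" and T: "T = R n" using assms(2) by blast
  then interpret measure_preserving_flow M R by simp
  show "bij_betw T (space M) (space M)" unfolding T by (rule bij_betw_flow)
  show "T \<in> measurable M M" unfolding T by (rule flow_measurable)
  show "inv_into (space M) T \<in> measurable M M"
    unfolding T using flow_measurable[of "- n"] inv_into_flow
    by (subst measurable_cong) auto
  fix A assume "A \<in> events"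
  then show "prob (pre_image M T A) = prob A" unfolding T by (rule measure_pre_image_flow)
qed

lemma shift_flow:
  assumes "prob_space N"
  shows "measure_preserving_flow (bernoulli N) shift"
proof -
  interpret prob_space "bernoulli N" using assms by (intro prob_space_PiM)
  show ?thesis
    by unfold_locales
      (auto simp: shift_measurable distr_shift assms, auto simp: shift_def fun_eq_iff algebra_simps)
qed

definition coordinatewise :: "(int \<Rightarrow> 'a \<Rightarrow> 'a) \<Rightarrow> int \<Rightarrow> (int \<Rightarrow> 'a) \<Rightarrow> int \<Rightarrow> 'a" where
  "coordinatewise R n \<omega> i = R n (\<omega> i)"

text \<open>
  Preimages of cylinders under a coordinatewise map are cylinders over the same index set, with each
  side replaced by its preimage; hence the product measure is preserved.
\<close>
lemma (in measure_preserving_flow) coordinatewise_flow: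
  "measure_preserving_flow (bernoulli M) (coordinatewise R)"
proof -
  interpret P: product_prob_space "\<lambda>_. M" "UNIV :: int set"
    by (intro product_prob_spaceI) unfold_locales
  note [measurable] = flow_measurable
  have "(\<lambda>\<omega> i. R n (\<omega> i)) \<in> measurable (bernoulli M) (bernoulli M)" for n
    by (rule measurable_PiM_single') (auto simp: space_PiM PiE_iff flow_space)
  then have meas: "coordinatewise R n \<in> measurable (bernoulli M) (bernoulli M)" for n
    by (simp add: coordinatewise_def[abs_def])
  have distr: "distr (bernoulli M) (bernoulli M) (coordinatewise R n) = bernoulli M" for n
  proof (rule P.PiM_eq)
    fix J :: "int set" and F assume J: "finite J" and F: "\<And>j. j \<in> J \<Longrightarrow> F j \<in> events"
    let ?F = "\<lambda>j. R n -` F j \<inter> space M"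
    have "coordinatewise R n -` prod_emb UNIV (\<lambda>_. M) J (Pi\<^sub>E J F) \<inter> space (bernoulli M)
        = prod_emb UNIV (\<lambda>_. M) J (Pi\<^sub>E J ?F)"
      by (auto simp: prod_emb_def space_PiM PiE_iff coordinatewise_def flow_space)
    then have "emeasure (distr (bernoulli M) (bernoulli M) (coordinatewise R n))
        (prod_emb UNIV (\<lambda>_. M) J (Pi\<^sub>E J F)) = (\<Prod>j\<in>J. emeasure M (?F j))"
      using J F by (simp add: emeasure_distr meas P.emeasure_PiM_emb sets_PiM_I measurable_sets[OF flow_measurable])
    also have "\<dots> = (\<Prod>j\<in>J. emeasure M (F j))"
      using emeasure_distr[OF flow_measurable F, of _ n, unfolded distr_flow, symmetric]
      by (intro prod.cong refl)
    finally show "emeasure (distr (bernoulli M) (bernoulli M) (coordinatewise R n))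
        (prod_emb UNIV (\<lambda>_. M) J (Pi\<^sub>E J F)) = (\<Prod>j\<in>J. emeasure M (F j))" .
  qed simp
  show ?thesis
    by unfold_locales
      (auto simp: meas distr,
       auto simp: coordinatewise_def fun_eq_iff space_PiM PiE_iff flow_0 flow_add)
qed

text \<open>
  A coordinatewise map treats all coordinates alike, so it commutes with relabelling them. This is
  how an ergodic transformation can commute with one that is far from ergodic.
\<close>
lemma coordinatewise_shift: "coordinatewise R m (shift n \<omega>) = shift n (coordinatewise R m \<omega>)"
  by (simp add: coordinatewise_def shift_def fun_eq_iff)

section \<open>Transfer of a system along an injection\<close>

definition small_recurrence ::
    "'a measure \<Rightarrow> ('a \<Rightarrow> 'a) \<Rightarrow> ('a \<Rightarrow> 'a) \<Rightarrow> ('a \<Rightarrow> 'a) \<Rightarrow> real \<Rightarrow> bool" where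
  "small_recurrence M T1 T2 T3 l \<longleftrightarrow>
     (\<exists>A\<in>sets M. \<forall>n :: int. n \<noteq> 0 \<longrightarrow>
        measure M (A \<inter> pre_image M (int_iterate M T1 n) A
                     \<inter> pre_image M (int_iterate M T2 n) A
                     \<inter> pre_image M (int_iterate M T3 n) A)
          < measure M A powr l)"

text \<open>
  Only the values on the range of \<open>f\<close> matter, where \<open>inv f\<close> is a genuine inverse.
\<close>
definition conjugate :: "('a \<Rightarrow> 'b) \<Rightarrow> ('a \<Rightarrow> 'a) \<Rightarrow> 'b \<Rightarrow> 'b" where
  "conjugate f T = f \<circ> T \<circ> inv f"

context
  fixes f :: "'a \<Rightarrow> 'b" and M :: "'a measure"
  assumes inj: "inj f"
begin

lemma conjugate_apply: "conjugate f T (f x) = f (T x)"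
  by (simp add: conjugate_def inj)

lemma measure_embed_image: "A \<in> sets M \<Longrightarrow> measure (embed_measure M f) (f ` A) = measure M A"
  using sets.sets_into_space[of A M] inj
  by (simp add: measure_def emeasure_embed_measure in_sets_embed_measure inj_vimage_image_eq Int_absorb2)

text \<open>
  The hypothesis only speaks of the space of \<open>M\<close>, so that the lemma also applies to the iterates
  of a conjugated map, which are conjugate to the iterates of the original map on that space alone.
\<close>
lemma pre_image_conjugate:
  assumes "\<And>x. x \<in> space M \<Longrightarrow> T' (f x) = f (T x)"
  shows "pre_image (embed_measure M f) T' (f ` A) = f ` pre_image M T A"
  using assms by (auto simp: pre_image_def inj_eq[OF inj] space_embed_measure)

lemma inv_into_conjugate:
  assumes bij: "bij_betw T (space M) (space M)" and x: "x \<in> space M"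
  shows "inv_into (space (embed_measure M f)) (conjugate f T) (f x) = f (inv_into (space M) T x)"
proof (rule inv_into_f_eq)
  have inv: "inv_into (space M) T x \<in> space M" "T (inv_into (space M) T x) = x"
    using bij x by (auto simp: bij_betw_def inv_into_into f_inv_into_f)
  then show "f (inv_into (space M) T x) \<in> space (embed_measure M f)"
    "conjugate f T (f (inv_into (space M) T x)) = f x"
    by (auto simp: space_embed_measure conjugate_apply)
  show "inj_on (conjugate f T) (space (embed_measure M f))"
    using bij inj by (auto simp: inj_on_def bij_betw_def space_embed_measure conjugate_apply)
qed

lemma int_iterate_conjugate:
  assumes bij: "bij_betw T (space M) (space M)" and x: "x \<in> space M"
  shows "int_iterate (embed_measure M f) (conjugate f T) n (f x) = f (int_iterate M T n x)"
proof -
  have pow: "(conjugate f T ^^ j) (f x) = f ((T ^^ j) x)" for j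
    by (induction j) (simp_all add: conjugate_apply)
  have "(inv_into (space M) T ^^ j) x \<in> space M \<and>
      (inv_into (space (embed_measure M f)) (conjugate f T) ^^ j) (f x)
        = f ((inv_into (space M) T ^^ j) x)" for j
  proof (induction j)
    case (Suc j)
    then have "inv_into (space M) T ((inv_into (space M) T ^^ j) x) \<in> space M"
      using bij by (metis bij_betw_def inv_into_into)
    then show ?case using Suc by (simp add: inv_into_conjugate[OF bij])
  qed (simp add: x)
  then show ?thesis by (simp add: int_iterate_def pow)
qed

lemma measurable_conjugate:
  assumes "T \<in> measurable M M" "\<And>x. x \<in> space M \<Longrightarrow> T' (f x) = f (T x)"
  shows "T' \<in> measurable (embed_measure M f) (embed_measure M f)"
proof (rule measurable_embed_measure1)
  have "(\<lambda>x. f (T x)) \<in> measurable M (embed_measure M f)"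
    by (rule measurable_compose[OF assms(1) measurable_embed_measure2[OF inj]])
  then show "(\<lambda>x. T' (f x)) \<in> measurable M (embed_measure M f)"
    using assms(2) by (subst measurable_cong) auto
qed

lemma measure_preserving_system_conjugate:
  assumes "measure_preserving_system M Ts"
  shows "measure_preserving_system (embed_measure M f) (map (conjugate f) Ts)"
  unfolding measure_preserving_system_def
proof (intro conjI ballI)
  interpret prob_space M using assms by (simp add: measure_preserving_system_def)
  show "prob_space (embed_measure M f)"
    by (subst embed_measure_eq_distr[OF inj], rule prob_space_distr) (rule measurable_embed_measure2[OF inj])
  fix T' assume "T' \<in> set (map (conjugate f) Ts)"
  then obtain T where "T \<in> set Ts" and T': "T' = conjugate f T" by auto
  with assms have bij: "bij_betw T (space M) (space M)" and T: "T \<in> measurable M M"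
    and Ti: "inv_into (space M) T \<in> measurable M M"
    and mp: "\<And>A. A \<in> events \<Longrightarrow> prob (pre_image M T A) = prob A"
    by (auto simp: measure_preserving_system_def)
  have "conjugate f T ` f ` space M = f ` T ` space M"
    by (simp add: image_image conjugate_apply)
  then show "bij_betw T' (space (embed_measure M f)) (space (embed_measure M f))"
    using bij unfolding T' space_embed_measure bij_betw_def
    by (simp add: inj_on_def inj_eq[OF inj] conjugate_apply)
  show "T' \<in> measurable (embed_measure M f) (embed_measure M f)"
    using T unfolding T' by (rule measurable_conjugate) (simp add: conjugate_apply)
  show "inv_into (space (embed_measure M f)) T' \<in> measurable (embed_measure M f) (embed_measure M f)"
    using Ti unfolding T' by (rule measurable_conjugate) (simp add: inv_into_conjugate bij)
  fix A' assume "A' \<in> sets (embed_measure M f)"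
  then obtain A where A: "A' = f ` A" "A \<in> events" by (auto simp: sets_embed_measure inj)
  have "pre_image M T A \<in> events" unfolding pre_image_def using T A(2) by (rule measurable_sets)
  then show "measure (embed_measure M f) (pre_image (embed_measure M f) T' A')
      = measure (embed_measure M f) A'"
    using A mp unfolding T' by (simp add: pre_image_conjugate conjugate_apply measure_embed_image)
qed

lemma commuting_system_conjugate:
  assumes "commuting_system M Ts"
  shows "commuting_system (embed_measure M f) (map (conjugate f) Ts)"
  using assms by (auto simp: commuting_system_def space_embed_measure conjugate_apply)

lemma ergodic_system_conjugate:
  assumes "ergodic_system M Ts"
  shows "ergodic_system (embed_measure M f) (map (conjugate f) Ts)"
  using assms inj
  by (auto simp: ergodic_system_def sets_embed_measure pre_image_conjugate conjugate_apply
      measure_embed_image inj_image_eq_iff)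

lemma small_recurrence_conjugate:
  assumes sys: "measure_preserving_system M [T1, T2, T3]" and "small_recurrence M T1 T2 T3 l"
  shows "small_recurrence (embed_measure M f) (conjugate f T1) (conjugate f T2) (conjugate f T3) l"
proof -
  have meas_iter: "int_iterate M T n \<in> measurable M M" if "T \<in> {T1, T2, T3}" for T n
  proof -
    have [measurable]: "T \<in> measurable M M" "inv_into (space M) T \<in> measurable M M"
      using sys that by (auto simp: measure_preserving_system_def)
    show ?thesis unfolding int_iterate_def by (auto intro!: measurable_compose_n)
  qed
  have pre: "pre_image (embed_measure M f) (int_iterate (embed_measure M f) (conjugate f T) n) (f ` A)
      = f ` pre_image M (int_iterate M T n) A" if "T \<in> {T1, T2, T3}" for T n A
    using sys that by (intro pre_image_conjugate int_iterate_conjugate)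
      (auto simp: measure_preserving_system_def)
  have meas_pre: "pre_image M (int_iterate M T n) A \<in> sets M"
    if "T \<in> {T1, T2, T3}" "A \<in> sets M" for T n A
    unfolding pre_image_def using measurable_sets[OF meas_iter[OF that(1)] that(2)] .
  obtain A where A: "A \<in> sets M" and small: "\<And>n. n \<noteq> 0 \<Longrightarrow>
        measure M (A \<inter> pre_image M (int_iterate M T1 n) A
                     \<inter> pre_image M (int_iterate M T2 n) A
                     \<inter> pre_image M (int_iterate M T3 n) A)
          < measure M A powr l"
    using assms(2) unfolding small_recurrence_def by blast
  show ?thesis
    unfolding small_recurrence_def
  proof (intro bexI[of _ "f ` A"] allI impI)
    show "f ` A \<in> sets (embed_measure M f)" using A by (rule in_sets_embed_measure)
    fix n :: int assume "n \<noteq> 0"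
    then show "measure (embed_measure M f)
        (f ` A \<inter> pre_image (embed_measure M f) (int_iterate (embed_measure M f) (conjugate f T1) n) (f ` A)
               \<inter> pre_image (embed_measure M f) (int_iterate (embed_measure M f) (conjugate f T2) n) (f ` A)
               \<inter> pre_image (embed_measure M f) (int_iterate (embed_measure M f) (conjugate f T3) n) (f ` A))
        < measure (embed_measure M f) (f ` A) powr l"
      using small A by (simp add: pre image_Int[OF inj, symmetric] measure_embed_image meas_pre sets.Int)
  qed
qed

end

text \<open>
  A real number carries as much information as a set of natural numbers, and countably many such
  sets can be merged into one set of tagged natural numbers.
\<close>
lemma ex_inj_sequences_to_real: "\<exists>f :: (int \<Rightarrow> real \<times> real) \<Rightarrow> real. inj f"
proof -
  obtain g :: "real \<Rightarrow> nat set" where g: "inj g"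
    using nat_sets_eqpoll_reals eqpoll_sym unfolding eqpoll_def bij_betw_def by blast
  obtain h :: "nat set \<Rightarrow> real" where h: "inj h"
    using nat_sets_eqpoll_reals unfolding eqpoll_def bij_betw_def by blast
  define code :: "(int \<Rightarrow> real \<times> real) \<Rightarrow> (int \<times> bool \<times> nat) set" where
    "code \<omega> = {(i, b, k). k \<in> g (if b then fst (\<omega> i) else snd (\<omega> i))}" for \<omega>
  have "inj code"
  proof (rule injI, rule ext)
    fix \<omega> \<eta> i assume eq: "code \<omega> = code \<eta>"
    have "g (if b then fst (\<omega> i) else snd (\<omega> i)) = g (if b then fst (\<eta> i) else snd (\<eta> i))" for b
      using arg_cong[OF eq, of "\<lambda>S. {k. (i, b, k) \<in> S}"] by (simp add: code_def)
    from this[of True] this[of False] show "\<omega> i = \<eta> i"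
      using g by (simp add: inj_eq prod_eq_iff)
  qed
  moreover have "inj (\<lambda>S :: (int \<times> bool \<times> nat) set. to_nat ` S)"
    by (simp add: inj_image_eq_iff inj_def[of "\<lambda>S. to_nat ` S"])
  ultimately have "inj (h \<circ> (\<lambda>S. to_nat ` S) \<circ> code)"
    using h by (intro inj_compose)
  then show ?thesis by blast
qed

section \<open>The circle and the skew action on the torus\<close>

definition circle :: "real measure" where
  "circle = restrict_space lborel {0..<1}"

lemma space_circle: "space circle = {0..<1}"
  by (simp add: circle_def space_restrict_space)

lemma sets_circle_iff: "A \<in> sets circle \<longleftrightarrow> A \<in> sets borel \<and> A \<subseteq> {0..<1}"
  by (auto simp: circle_def sets_restrict_space_iff)

lemma emeasure_circle: "A \<in> sets circle \<Longrightarrow> emeasure circle A = emeasure lborel A"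
  unfolding sets_circle_iff by (auto simp: circle_def emeasure_restrict_space)

interpretation circle: prob_space circle
  unfolding circle_def by (rule prob_space_restrict_space) auto

lemma measurable_circle_borel: "(\<lambda>x. x) \<in> borel_measurable circle"
  unfolding circle_def by (rule measurable_restrict_space1) simp

lemma frac_measurable_circle:
  assumes "f \<in> borel_measurable M"
  shows "(\<lambda>x. frac (f x)) \<in> measurable M circle"
proof -
  have "(\<lambda>x. frac (f x)) \<in> borel_measurable M"
    using assms unfolding frac_def by measurable
  then show ?thesis
    unfolding circle_def
    by (intro measurable_restrict_space2) (auto simp: frac_lt_1)
qed

lemma rotation_measurable: "(\<lambda>y. frac (y + c)) \<in> measurable circle circle"
  by (rule frac_measurable_circle) (use measurable_circle_borel in simp)

text \<open>
  On \<open>[0, 1)\<close> a rotation exchanges two intervals by translations, so translation invariance of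
  Lebesgue measure applies to the two pieces.
\<close>
lemma distr_rotation: "distr circle circle (\<lambda>y. frac (y + c)) = circle"
proof (rule measure_eqI)
  fix B assume "B \<in> sets (distr circle circle (\<lambda>y. frac (y + c)))"
  then have B: "B \<in> sets circle" by simp
  define r where "r = frac c"
  have r: "0 \<le> r" "r < 1" by (auto simp: r_def frac_lt_1)
  have rot: "frac (y + c) = (if r + y < 1 then r + y else r - 1 + y)" if "0 \<le> y" "y < 1" for y
    using that by (simp add: frac_add r_def)
  have translate: "emeasure lborel ((+) s -` X) = emeasure lborel X" if "X \<in> sets borel" for s :: real and X
    using that emeasure_distr[of "(+) s" lborel borel X] by (simp add: lborel_distr_plus)
  have translate_sets: "(+) s -` X \<in> sets borel" if "X \<in> sets borel" for s :: real and X
    using measurable_sets[OF _ that, of "(+) s" borel] by simp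
  have Bb: "B \<inter> {r..<1} \<in> sets borel" "B \<inter> {0..<r} \<in> sets borel"
    using B by (auto simp: sets_circle_iff)
  have "(\<lambda>y. frac (y + c)) -` B \<inter> space circle
      = (+) r -` (B \<inter> {r..<1}) \<union> (+) (r - 1) -` (B \<inter> {0..<r})" (is "?pre = ?U")
  proof (rule set_eqI)
    fix y
    show "y \<in> ?pre \<longleftrightarrow> y \<in> ?U"
      using rot[of y] r by (cases "r + y < 1") (auto simp: space_circle)
  qed
  then have "emeasure (distr circle circle (\<lambda>y. frac (y + c))) B = emeasure lborel ?U"
    using measurable_sets[OF rotation_measurable B, of c] B
    by (simp add: emeasure_distr[OF rotation_measurable] emeasure_circle)
  also have "\<dots> = emeasure lborel ((+) r -` (B \<inter> {r..<1})) + emeasure lborel ((+) (r - 1) -` (B \<inter> {0..<r}))"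
    using r translate_sets[OF Bb(1), of r] translate_sets[OF Bb(2), of "r - 1"]
    by (intro plus_emeasure[symmetric]) auto
  also have "\<dots> = emeasure lborel (B \<inter> {r..<1}) + emeasure lborel (B \<inter> {0..<r})"
    by (simp only: translate Bb)
  also have "\<dots> = emeasure lborel ((B \<inter> {r..<1}) \<union> (B \<inter> {0..<r}))"
    using Bb by (intro plus_emeasure) auto
  also have "(B \<inter> {r..<1}) \<union> (B \<inter> {0..<r}) = B"
    using B r by (auto simp: sets_circle_iff)
  finally show "emeasure (distr circle circle (\<lambda>y. frac (y + c))) B = emeasure circle B"
    using B by (simp add: emeasure_circle)
qed simp

abbreviation torus :: "(real \<times> real) measure" where
  "torus \<equiv> circle \<Otimes>\<^sub>M circle"

interpretation torus: pair_prob_space circle circle ..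

text \<open>
  The powers of \<open>(x, y) \<mapsto> (x, y + x)\<close>. The first coordinate is the rotation speed and never changes,
  so that the orbit of a point lies in a single fibre and its second coordinate moves along an
  arithmetic progression.
\<close>
definition skew :: "int \<Rightarrow> real \<times> real \<Rightarrow> real \<times> real" where
  "skew n p = (fst p, frac (snd p + of_int n * fst p))"

lemma skew_measurable: "skew n \<in> measurable torus torus"
proof -
  have [measurable]: "fst \<in> borel_measurable torus" "snd \<in> borel_measurable torus"
    using measurable_compose[OF measurable_fst measurable_circle_borel]
      measurable_compose[OF measurable_snd measurable_circle_borel] by auto
  have "(\<lambda>p. frac (snd p + of_int n * fst p)) \<in> measurable torus circle"
    by (rule frac_measurable_circle) measurable
  then show ?thesis
    unfolding skew_def[abs_def] by (intro measurable_Pair measurable_fst)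
qed

text \<open>
  By Fubini, since each fibre is rotated by a constant.
\<close>
lemma distr_skew: "distr torus torus (skew n) = torus"
proof (rule measure_eqI)
  fix A assume "A \<in> sets (distr torus torus (skew n))"
  then have A: "A \<in> sets torus" by simp
  have "emeasure (distr torus torus (skew n)) A = emeasure torus (skew n -` A \<inter> space torus)"
    using skew_measurable A by (rule emeasure_distr)
  also have "\<dots> = (\<integral>\<^sup>+x. emeasure circle (Pair x -` (skew n -` A \<inter> space torus)) \<partial>circle)"
    using measurable_sets[OF skew_measurable A] by (rule circle.emeasure_pair_measure_alt)
  also have "\<dots> = (\<integral>\<^sup>+x. emeasure circle (Pair x -` A) \<partial>circle)"
  proof (rule nn_integral_cong)
    fix x assume x: "x \<in> space circle"
    have "Pair x -` (skew n -` A \<inter> space torus)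
        = (\<lambda>y. frac (y + of_int n * x)) -` (Pair x -` A) \<inter> space circle"
      using x by (auto simp: skew_def space_pair_measure)
    then show "emeasure circle (Pair x -` (skew n -` A \<inter> space torus)) = emeasure circle (Pair x -` A)"
      using emeasure_distr[OF rotation_measurable sets_Pair1[OF A], of "of_int n * x" x]
      by (simp add: distr_rotation)
  qed
  also have "\<dots> = emeasure torus A" using A by (rule circle.emeasure_pair_measure_alt[symmetric])
  finally show "emeasure (distr torus torus (skew n)) A = emeasure torus A" .
qed simp

lemma skew_flow: "measure_preserving_flow torus skew"
proof
  fix p :: "real \<times> real" and m n
  assume "p \<in> space torus"
  then show "skew 0 p = p"
    by (cases p) (auto simp: skew_def space_pair_measure space_circle)
  show "skew m (skew n p) = skew (m + n) p"
    by (simp add: skew_def algebra_simps)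
qed (rule skew_measurable distr_skew)+

definition near_integer :: "real \<Rightarrow> real \<Rightarrow> bool" where
  "near_integer \<eta> t \<longleftrightarrow> (\<exists>k :: int. \<bar>t - of_int k\<bar> < \<eta>)"

lemma near_integer_multiple_set:
  "{x \<in> {0..<1}. near_integer \<eta> (of_int n * x)} \<in> sets circle"
proof -
  have "{x \<in> {0..<1}. near_integer \<eta> (of_int n * x)}
      = {0..<1} \<inter> (\<Union>k::int. {x. \<bar>of_int n * x - of_int k\<bar> < \<eta>})"
    by (auto simp: near_integer_def)
  moreover have "{x. \<bar>of_int n * x - of_int k\<bar> < \<eta>} \<in> sets borel" for k :: int
    by measurable
  ultimately show ?thesis by (auto simp: sets_circle_iff)
qed

text \<open>
  The points are covered by the \<open>\<bar>n\<bar> + 1\<close> intervals of length \<open>2\<eta> / \<bar>n\<bar>\<close> around the multiples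
  \<open>k / \<bar>n\<bar>\<close>, and \<open>\<bar>n\<bar> + 1 \<le> 2\<bar>n\<bar>\<close>. What matters is that the bound does not depend on \<open>n\<close>.
\<close>
lemma measure_near_integer_multiple:
  assumes n: "n \<noteq> 0" and \<eta>: "0 < \<eta>" "\<eta> \<le> 1"
  shows "measure circle {x \<in> {0..<1}. near_integer \<eta> (of_int n * x)} \<le> 4 * \<eta>"
proof -
  define a where "a = \<bar>real_of_int n\<bar>"
  have a: "a \<ge> 1" using n by (simp add: a_def)
  let ?S = "{x \<in> {0..<1}. near_integer \<eta> (of_int n * x)}"
  let ?J = "\<lambda>k::int. {(of_int k - \<eta>) / a <..< (of_int k + \<eta>) / a}"
  have sub: "?S \<subseteq> (\<Union>k\<in>{0..\<bar>n\<bar>}. ?J k)"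
  proof
    fix x assume "x \<in> ?S"
    then obtain j :: int where x: "0 \<le> x" "x < 1" and j: "\<bar>of_int n * x - of_int j\<bar> < \<eta>"
      by (auto simp: near_integer_def)
    \<comment> \<open>For negative \<open>n\<close> everything is reflected, so that only multiples of \<open>1 / \<bar>n\<bar>\<close> occur.\<close>
    define k where "k = sgn n * j"
    have "of_int n * x - of_int j = sgn (of_int n) * (a * x - of_int k)"
      using n by (auto simp: a_def k_def sgn_if)
    then have k: "\<bar>a * x - of_int k\<bar> < \<eta>" using j n by (simp add: abs_mult)
    have "0 \<le> a * x" "a * x < a" using x a by auto
    then have "-1 < real_of_int k" "real_of_int k < real_of_int (\<bar>n\<bar> + 1)"
      using k \<eta> by (auto simp: a_def)
    then have "k \<in> {0..\<bar>n\<bar>}" by auto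
    moreover have "x \<in> ?J k" using k a by (auto simp: field_simps abs_less_iff)
    ultimately show "x \<in> (\<Union>k\<in>{0..\<bar>n\<bar>}. ?J k)" by blast
  qed
  have len: "(of_int k + \<eta>) / a - (of_int k - \<eta>) / a = 2 * \<eta> / a" for k :: int
    by (simp add: diff_divide_distrib[symmetric])
  have "emeasure circle ?S = emeasure lborel ?S"
    by (rule emeasure_circle[OF near_integer_multiple_set])
  also have "\<dots> \<le> emeasure lborel (\<Union>k\<in>{0..\<bar>n\<bar>}. ?J k)"
    by (rule emeasure_mono[OF sub]) auto
  also have "\<dots> \<le> (\<Sum>k\<in>{0..\<bar>n\<bar>}. emeasure lborel (?J k))"
    by (rule emeasure_subadditive_finite) auto
  also have "\<dots> = (\<Sum>k\<in>{0..\<bar>n\<bar>}. ennreal (2 * \<eta> / a))"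
  proof (rule sum.cong[OF refl])
    fix k :: int
    have "(of_int k - \<eta>) / a \<le> (of_int k + \<eta>) / a"
      using a \<eta> by (intro divide_right_mono) auto
    then show "emeasure lborel (?J k) = ennreal (2 * \<eta> / a)" by (simp add: len)
  qed
  also have "\<dots> = ennreal ((a + 1) * (2 * \<eta> / a))"
    using \<eta> a by (subst sum_ennreal) (auto simp: a_def)
  also have "\<dots> \<le> ennreal (4 * \<eta>)"
  proof (rule ennreal_leI)
    have "(a + 1) * (2 * \<eta> / a) = 2 * \<eta> * ((a + 1) / a)" by simp
    also have "\<dots> \<le> 2 * \<eta> * 2" using a \<eta> by (intro mult_left_mono) (auto simp: field_simps)
    finally show "(a + 1) * (2 * \<eta> / a) \<le> 4 * \<eta>" by simp
  qed
  finally show ?thesis using \<eta> by (simp add: circle.emeasure_eq_measure)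
qed

section \<open>Progressions in a spherical shell\<close>

text \<open>
  The second difference of the three representatives is an integer, and it lies strictly between
  \<open>-1\<close> and \<open>1\<close> when they belong to \<open>[0, 1/2)\<close>. So a progression modulo \<open>1\<close> inside the half circle
  is a progression of real numbers.
\<close>
lemma progression_in_half_circle:
  fixes t y :: real
  assumes "0 \<le> y" "y < 1/2" "frac (y + t) < 1/2" "frac (y + 2 * t) < 1/2"
  shows "frac (y + 2 * t) = 2 * frac (y + t) - y" "\<exists>k :: int. frac (y + t) - y = t - of_int k"
proof -
  have a: "frac (y + t) = y + t - of_int \<lfloor>y + t\<rfloor>" by (simp add: frac_def)
  have b: "frac (y + 2 * t) = y + 2 * t - of_int \<lfloor>y + 2 * t\<rfloor>" by (simp add: frac_def)
  show "\<exists>k :: int. frac (y + t) - y = t - of_int k" using a by (intro exI[of _ "\<lfloor>y + t\<rfloor>"]) simp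
  have "\<bar>real_of_int (2 * \<lfloor>y + t\<rfloor> - \<lfloor>y + 2 * t\<rfloor>)\<bar> < 1"
    using a b assms frac_ge_0[of "y + t"] frac_ge_0[of "y + 2 * t"] by (simp only: of_int_diff of_int_mult)
  then have "2 * \<lfloor>y + t\<rfloor> = \<lfloor>y + 2 * t\<rfloor>" by linarith
  then show "frac (y + 2 * t) = 2 * frac (y + t) - y" using a b by linarith
qed

text \<open>
  This is the continuous form of Behrend's observation that a sphere contains no three points in
  progression. If \<open>h\<close> is the common difference, the parallelogram law reads
  \<open>\<bar>y\<bar>\<^sup>2 + \<bar>y + 2h\<bar>\<^sup>2 - 2 \<bar>y + h\<bar>\<^sup>2 = 2 \<bar>h\<bar>\<^sup>2\<close>. In a shell of squared radii \<open>[s, s + \<eta>\<^sup>2)\<close> the left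
  side is less than \<open>2 \<eta>\<^sup>2\<close>, so every coordinate of \<open>h\<close> is less than \<open>\<eta>\<close> in absolute value.
\<close>
lemma progression_in_shell:
  fixes y t :: "'i \<Rightarrow> real"
  assumes I: "finite I"
    and y: "\<And>i. i \<in> I \<Longrightarrow> 0 \<le> y i \<and> y i < 1/2"
      "\<And>i. i \<in> I \<Longrightarrow> frac (y i + t i) < 1/2" "\<And>i. i \<in> I \<Longrightarrow> frac (y i + 2 * t i) < 1/2"
    and s: "(\<Sum>i\<in>I. (y i)\<^sup>2) < s + \<eta>\<^sup>2" "s \<le> (\<Sum>i\<in>I. (frac (y i + t i))\<^sup>2)"
      "(\<Sum>i\<in>I. (frac (y i + 2 * t i))\<^sup>2) < s + \<eta>\<^sup>2"
    and \<eta>: "0 < \<eta>" and i: "i \<in> I"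
  shows "near_integer \<eta> (t i)"
proof -
  define h where "h i = frac (y i + t i) - y i" for i
  have third: "(frac (y i + 2 * t i))\<^sup>2 = 2 * (frac (y i + t i))\<^sup>2 - (y i)\<^sup>2 + 2 * (h i)\<^sup>2" if "i \<in> I" for i
  proof -
    have *: "frac (y i + 2 * t i) = 2 * frac (y i + t i) - y i"
      using y[OF that] by (intro progression_in_half_circle) auto
    show ?thesis unfolding * h_def by (simp add: power2_eq_square algebra_simps)
  qed
  have "(\<Sum>i\<in>I. (frac (y i + 2 * t i))\<^sup>2)
      = 2 * (\<Sum>i\<in>I. (frac (y i + t i))\<^sup>2) - (\<Sum>i\<in>I. (y i)\<^sup>2) + 2 * (\<Sum>i\<in>I. (h i)\<^sup>2)"
    by (simp add: third sum.distrib sum_subtractf sum_distrib_left)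
  then have "(\<Sum>i\<in>I. (h i)\<^sup>2) < \<eta>\<^sup>2" using s by linarith
  moreover have "(h i)\<^sup>2 \<le> (\<Sum>i\<in>I. (h i)\<^sup>2)" using I i by (intro member_le_sum) auto
  ultimately have "\<bar>h i\<bar> < \<eta>" using \<eta> 
    by (intro power2_less_imp_less[of "\<bar>h i\<bar>"]) auto
  moreover obtain k :: int where "h i = t i - of_int k"
    using progression_in_half_circle(2)[of "y i" "t i"] y[OF i] by (auto simp: h_def)
  ultimately show ?thesis unfolding near_integer_def by auto
qed

section \<open>The system and its large shells\<close>

abbreviation torus_sequences :: "(int \<Rightarrow> real \<times> real) measure" where
  "torus_sequences \<equiv> bernoulli torus"

abbreviation shear :: "int \<Rightarrow> (int \<Rightarrow> real \<times> real) \<Rightarrow> int \<Rightarrow> real \<times> real" where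
  "shear \<equiv> coordinatewise skew"

interpretation shear: measure_preserving_flow torus_sequences shear
  by (rule measure_preserving_flow.coordinatewise_flow[OF skew_flow])

text \<open>
  A Behrend set in the second coordinates of the positions in \<open>I\<close>: those points of the cube
  \<open>[0, 1/2)\<^sup>I\<close> whose squared distance from the origin lies in \<open>[s, s + \<eta>\<^sup>2)\<close>.
\<close>
definition shell :: "int set \<Rightarrow> real \<Rightarrow> real \<Rightarrow> (int \<Rightarrow> real \<times> real) set" where
  "shell I s \<eta> = {\<omega> \<in> space torus_sequences. (\<forall>i\<in>I. snd (\<omega> i) < 1/2) \<and>
     s \<le> (\<Sum>i\<in>I. (snd (\<omega> i))\<^sup>2) \<and> (\<Sum>i\<in>I. (snd (\<omega> i))\<^sup>2) < s + \<eta>\<^sup>2}"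

lemma torus_sequences_coordinate:
  assumes "\<omega> \<in> space torus_sequences"
  shows "0 \<le> fst (\<omega> i)" "fst (\<omega> i) < 1" "0 \<le> snd (\<omega> i)" "snd (\<omega> i) < 1"
proof -
  have "\<omega> i \<in> {0..<1} \<times> {0..<1}"
    using assms by (auto simp: space_PiM space_pair_measure space_circle PiE_iff)
  then show "0 \<le> fst (\<omega> i)" "fst (\<omega> i) < 1" "0 \<le> snd (\<omega> i)" "snd (\<omega> i) < 1"
    by (auto simp: mem_Times_iff)
qed

lemma shell_measurable:
  assumes "finite I"
  shows "shell I s \<eta> \<in> sets torus_sequences"
proof -
  have [measurable]: "(\<lambda>\<omega>. snd (\<omega> i)) \<in> borel_measurable torus_sequences" for i
    by (rule measurable_compose[OF _ measurable_compose[OF measurable_snd measurable_circle_borel]])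
      (rule measurable_component_singleton, simp)
  show ?thesis unfolding shell_def using assms by measurable
qed

lemma measure_box:
  assumes I: "finite I" and E: "E \<in> sets torus"
  shows "measure torus_sequences {\<omega> \<in> space torus_sequences. \<forall>i\<in>I. \<omega> i \<in> E}
    = measure torus E ^ card I"
proof -
  interpret P: product_prob_space "\<lambda>_. torus" "UNIV :: int set"
    by (intro product_prob_spaceI) unfold_locales
  have "ennreal (shear.prob {\<omega> \<in> space torus_sequences. \<forall>i\<in>I. \<omega> i \<in> E})
      = ennreal (measure torus E ^ card I)"
    using P.emeasure_PiM_Collect[of I "\<lambda>_. E"] I E
    by (simp add: shear.emeasure_eq_measure torus.emeasure_eq_measure ennreal_power)
  then show ?thesis by simp
qed

lemma measure_torus_Times:
  assumes "A \<in> sets circle" "B \<in> sets circle"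
  shows "measure torus (A \<times> B) = measure circle A * measure circle B"
proof -
  have "ennreal (measure torus (A \<times> B)) = ennreal (measure circle A * measure circle B)"
    using circle.emeasure_pair_measure_Times[OF assms]
    by (simp add: torus.emeasure_eq_measure circle.emeasure_eq_measure ennreal_mult)
  then show ?thesis by simp
qed

text \<open>
  Squared norms in the cube \<open>[0, 1/2)\<^sup>I\<close> are less than \<open>\<bar>I\<bar> / 4 = K \<eta>\<^sup>2\<close>, so \<open>K\<close> shells cover the cube
  and one of them has at least the average measure.
\<close>
lemma exists_heavy_shell:
  assumes I: "finite I" "I \<noteq> {}" and K: "real (card I) / 4 = real K * \<eta>\<^sup>2"
  obtains s where "(1/2) ^ card I \<le> real K * measure torus_sequences (shell I s \<eta>)"
proof -
  let ?H = "{\<omega> \<in> space torus_sequences. \<forall>i\<in>I. \<omega> i \<in> {0..<1} \<times> {0..<1/2}}"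
  let ?sh = "\<lambda>k. shell I (real k * \<eta>\<^sup>2) \<eta>"
  have half: "{0..<1/2} \<in> sets circle" "{0..<1} \<in> sets circle" by (auto simp: sets_circle_iff)
  have "measure circle X = measure lborel X" if "X \<in> sets circle" for X
    using that by (simp add: measure_def emeasure_circle)
  then have lengths: "measure circle {0..<1/2} = 1/2" "measure circle {0..<1} = 1"
    using half by auto
  have "shear.prob ?H = (1/2) ^ card I"
    by (simp only: measure_box[OF I(1) pair_measureI[OF half(2,1)]]
        measure_torus_Times[OF half(2,1)] lengths mult_1_left)
  then have "(1/2) ^ card I = shear.prob ?H" by (rule sym)
  also have "\<dots> \<le> shear.prob (\<Union>k<K. ?sh k)"
  proof (rule shear.finite_measure_mono)
    show "?H \<subseteq> (\<Union>k<K. ?sh k)"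
    proof
      fix \<omega> assume \<omega>: "\<omega> \<in> ?H"
      let ?q = "\<Sum>i\<in>I. (snd (\<omega> i))\<^sup>2"
      have y: "0 \<le> snd (\<omega> i)" "snd (\<omega> i) < 1/2" if "i \<in> I" for i
        using \<omega> that by (auto simp: mem_Times_iff)
      have "?q < (\<Sum>i\<in>I. 1/4)"
      proof (rule sum_strict_mono)
        fix i assume "i \<in> I"
        from power_strict_mono[OF y(2,1)[OF this], of 2] show "(snd (\<omega> i))\<^sup>2 < 1/4"
          by (simp add: power_divide)
      qed (use I in auto)
      then have q: "?q < real K * \<eta>\<^sup>2" using K by simp
      moreover have "0 \<le> ?q" by (simp add: sum_nonneg)
      ultimately have \<eta>: "0 < \<eta>\<^sup>2" by (cases "\<eta> = 0") auto
      define k where "k = nat \<lfloor>?q / \<eta>\<^sup>2\<rfloor>"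
      have "0 \<le> ?q / \<eta>\<^sup>2" using \<open>0 \<le> ?q\<close> by simp
      then have "real k \<le> ?q / \<eta>\<^sup>2" "?q / \<eta>\<^sup>2 < real k + 1" unfolding k_def by linarith+
      then have k: "real k * \<eta>\<^sup>2 \<le> ?q" "?q < real k * \<eta>\<^sup>2 + \<eta>\<^sup>2"
        using \<eta> by (auto simp: field_simps)
      then have "real k * \<eta>\<^sup>2 < real K * \<eta>\<^sup>2" using q by linarith
      then have "k < K" using \<eta> by simp
      moreover have "\<omega> \<in> ?sh k" using \<omega> y k by (auto simp: shell_def)
      ultimately show "\<omega> \<in> (\<Union>k<K. ?sh k)" by blast
    qed
  qed (use I shell_measurable in auto)
  also have "\<dots> \<le> (\<Sum>k<K. shear.prob (?sh k))"
    using I shell_measurable by (intro shear.finite_measure_subadditive_finite) auto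
  finally have total: "(1/2) ^ card I \<le> (\<Sum>k<K. shear.prob (?sh k))" .
  show thesis
  proof (rule ccontr)
    assume "\<not> thesis"
    then have small: "real K * shear.prob (?sh k) < (1/2) ^ card I" for k
      using that not_le by blast
    have "K > 0" using K I by (cases K) auto
    then have "(\<Sum>k<K. real K * shear.prob (?sh k)) < (\<Sum>k<K. (1/2) ^ card I)"
      using small by (intro sum_strict_mono) auto
    then have "real K * (\<Sum>k<K. shear.prob (?sh k)) < real K * (1/2) ^ card I"
      by (simp add: sum_distrib_left)
    then show False using total \<open>K > 0\<close> by simp
  qed
qed

text \<open>
  A point in the intersection has, at each position in \<open>I\<close>, a three-term progression with common
  difference \<open>n x\<^sub>i\<close>, so \<open>n x\<^sub>i\<close> is close to an integer for every \<open>i\<close> in \<open>I\<close>. These are independent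
  events of measure at most \<open>4 \<eta>\<close>.
\<close>
lemma measure_shell_progression:
  assumes I: "finite I" and \<eta>: "0 < \<eta>" "\<eta> \<le> 1" and n: "n \<noteq> 0"
  shows "measure torus_sequences
      (shell I s \<eta> \<inter> shear n -` shell I s \<eta> \<inter> shear (2 * n) -` shell I s \<eta>) \<le> (4 * \<eta>) ^ card I"
    (is "measure _ ?P \<le> _")
proof -
  let ?N = "{x \<in> {0..<1}. near_integer \<eta> (of_int n * x)}"
  let ?Q = "{\<omega> \<in> space torus_sequences. \<forall>i\<in>I. \<omega> i \<in> ?N \<times> {0..<1}}"
  have N: "?N \<in> sets circle" and U: "{0..<1} \<in> sets circle"
    using near_integer_multiple_set by (auto simp: sets_circle_iff)
  have NU: "?N \<times> {0..<1} \<in> sets torus" using N U by (rule pair_measureI)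
  have "?P \<subseteq> ?Q"
  proof
    fix \<omega> assume \<omega>: "\<omega> \<in> ?P"
    then have sp: "\<omega> \<in> space torus_sequences" by (simp add: shell_def)
    note coord = torus_sequences_coordinate[OF sp]
    have "near_integer \<eta> (of_int n * fst (\<omega> i))" if "i \<in> I" for i
      by (rule progression_in_shell[where y = "\<lambda>i. snd (\<omega> i)" and s = s and I = I])
        (use \<omega> \<eta> I that coord in
          \<open>auto simp: shell_def coordinatewise_def skew_def mult.assoc\<close>)
    then show "\<omega> \<in> ?Q" using sp coord by (auto simp: mem_Times_iff)
  qed
  moreover have "?Q \<in> sets torus_sequences"
    using I NU by measurable
  ultimately have "shear.prob ?P \<le> shear.prob ?Q" by (rule shear.finite_measure_mono)
  also have "\<dots> = (measure circle ?N * measure circle {0..<1}) ^ card I"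
    by (simp only: measure_box[OF I NU] measure_torus_Times[OF N U])
  also have "\<dots> \<le> (4 * \<eta>) ^ card I"
  proof (rule power_mono)
    have "measure circle ?N * measure circle {0..<1} \<le> measure circle ?N * 1"
      by (intro mult_left_mono circle.prob_le_1 measure_nonneg)
    also have "\<dots> \<le> 4 * \<eta>" using measure_near_integer_multiple[OF n \<eta>] by simp
    finally show "measure circle ?N * measure circle {0..<1} \<le> 4 * \<eta>" .
  qed simp
  finally show ?thesis .
qed

text \<open>
  As \<open>m\<close> grows, the left side decays like \<open>m\<close> to the power \<open>- 4p\<close>, the right side only like \<open>m\<close>
  to the power \<open>- 2l\<close>. Here \<open>4p\<close> is the dimension of the shells, \<open>1/m\<close> plays the role of \<open>\<eta>\<close>, and
  \<open>p m\<^sup>2\<close> is the number of shells that cover the cube.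
\<close>
lemma exists_scale:
  fixes l :: real
  assumes "0 < l" "l < real p"
  obtains m :: nat where "0 < m"
    "(4 * (1 / real m)) ^ (4 * p) < ((1/2) ^ (4 * p) / real (p * m\<^sup>2)) powr l"
proof -
  have p: "1 \<le> real p" using assms by (cases p) auto
  then have exponent: "1 - real (4 * p) \<le> - 2 * l"
    using assms(2) unfolding of_nat_mult by linarith
  define C where "C = ((1/2) ^ (4 * p) / real p) powr l"
  have C: "0 < C" using p by (simp add: C_def)
  obtain m0 :: nat where m0: "4 ^ (4 * p) / C < real m0" using reals_Archimedean2 by blast
  define m where "m = Suc m0"
  have m: "1 \<le> real m" "4 ^ (4 * p) < C * real m"
    using m0 C by (auto simp: m_def field_simps)
  have "(4 * (1 / real m)) ^ (4 * p) = 4 ^ (4 * p) * real m powr (- real (4 * p))"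
    using m powr_realpow[of "real m" "4 * p"]
    by (simp add: power_mult_distrib powr_minus divide_inverse power_inverse)
  also have "\<dots> < C * real m * real m powr (- real (4 * p))"
    using m by (intro mult_strict_right_mono) auto
  also have "\<dots> = C * real m powr (1 - real (4 * p))"
    using m by (simp add: powr_diff powr_minus divide_inverse)
  also have "\<dots> \<le> C * real m powr (- 2 * l)"
    using m C exponent by (intro mult_left_mono powr_mono) auto
  also have "\<dots> = ((1/2) ^ (4 * p) / real (p * m\<^sup>2)) powr l"
  proof -
    have "(1/2) ^ (4 * p) / real (p * m\<^sup>2) = ((1/2) ^ (4 * p) / real p) * real m powr (- 2)"
      using m by (simp add: powr_minus_divide[of "real m" 2])
    then have "((1/2) ^ (4 * p) / real (p * m\<^sup>2)) powr l
        = ((1/2) ^ (4 * p) / real p) powr l * (real m powr (- 2)) powr l"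
      by (simp only: powr_mult)
    then show ?thesis unfolding C_def powr_powr by (rule sym)
  qed
  finally show thesis using that[of m] m by simp
qed

text \<open>
  The third transformation is the square of the second one, so a common return at time \<open>n\<close> under
  these two produces a three-term progression in the shell, which is already rare enough.
\<close>
lemma small_recurrence_torus_sequences:
  assumes l: "0 < l"
  shows "small_recurrence torus_sequences (shift 1) (shear 1) (shear 2) l"
proof -
  obtain p :: nat where p: "l < real p" using reals_Archimedean2 by blast
  obtain m :: nat where m: "0 < m"
    and scale: "(4 * (1 / real m)) ^ (4 * p) < ((1/2) ^ (4 * p) / real (p * m\<^sup>2)) powr l"
    using exists_scale[OF l p] .
  define I where "I = {0..<int (4 * p)}"
  define \<eta> where "\<eta> = 1 / real m"
  have \<eta>: "0 < \<eta>" "\<eta> \<le> 1" using m by (auto simp: \<eta>_def)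
  have "0 < p" using l p by (cases p) auto
  then have I: "finite I" "I \<noteq> {}" "card I = 4 * p" by (auto simp: I_def)
  obtain s where s: "(1/2) ^ card I \<le> real (p * m\<^sup>2) * measure torus_sequences (shell I s \<eta>)"
    by (rule exists_heavy_shell[OF I(1,2), of "p * m\<^sup>2" \<eta>])
      (use m I(3) in \<open>auto simp: \<eta>_def power_divide\<close>)
  let ?A = "shell I s \<eta>"
  note A = shell_measurable[OF I(1), of s \<eta>]
  show ?thesis
    unfolding small_recurrence_def
  proof (intro bexI[OF _ A] allI impI)
    fix n :: int assume n: "n \<noteq> 0"
    let ?pre = "\<lambda>T. pre_image torus_sequences (int_iterate torus_sequences T n) ?A"
    have pre: "?pre (shear k) = shear (k * n) -` ?A \<inter> space torus_sequences" for k
      by (auto simp: pre_image_def shear.int_iterate_flow)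
    have "shear.prob (?A \<inter> ?pre (shift 1) \<inter> ?pre (shear 1) \<inter> ?pre (shear 2))
        \<le> shear.prob (?A \<inter> shear n -` ?A \<inter> shear (2 * n) -` ?A)"
    proof (rule shear.finite_measure_mono)
      have "?A \<inter> shear n -` ?A \<inter> shear (2 * n) -` ?A
          = ?A \<inter> (shear n -` ?A \<inter> space torus_sequences) \<inter> (shear (2 * n) -` ?A \<inter> space torus_sequences)"
        by (auto simp: shell_def)
      then show "?A \<inter> shear n -` ?A \<inter> shear (2 * n) -` ?A \<in> sets torus_sequences"
        using A measurable_sets[OF shear.flow_measurable A] by auto
    qed (auto simp: pre)
    also have "\<dots> \<le> (4 * \<eta>) ^ card I"
      by (rule measure_shell_progression[OF I(1) \<eta> n])
    also have "\<dots> < ((1/2) ^ (4 * p) / real (p * m\<^sup>2)) powr l"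
      using scale by (simp add: \<eta>_def I(3))
    also have "\<dots> \<le> shear.prob ?A powr l"
    proof (rule powr_mono2)
      show "(1/2) ^ (4 * p) / real (p * m\<^sup>2) \<le> shear.prob ?A"
        using s m \<open>0 < p\<close> unfolding I(3) by (simp add: field_simps)
    qed (use l in auto)
    finally show "shear.prob (?A \<inter> ?pre (shift 1) \<inter> ?pre (shear 1) \<inter> ?pre (shear 2))
        < shear.prob ?A powr l" .
  qed
qed

lemma measure_preserving_torus_sequences:
  "measure_preserving_system torus_sequences [shift 1, shear 1, shear 2]"
  using shift_flow[OF torus.prob_space_axioms] shear.measure_preserving_flow_axioms
  by (intro measure_preserving_systemI shear.prob_space_axioms) auto

lemma commuting_torus_sequences: "commuting_system torus_sequences [shift 1, shear 1, shear 2]"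
  by (auto simp: commuting_system_def coordinatewise_shift shear.flow_add)

lemma ergodic_torus_sequences: "ergodic_system torus_sequences [shift 1, shear 1, shear 2]"
  using bernoulli_shift_zero_one[OF torus.prob_space_axioms] by (auto simp: ergodic_system_def)

section \<open>The theorem\<close>

theorem theorem1p3:
  shows "\<exists>(M :: (real \<times> real \<times> real) measure) T1 T2 T3.
    measure_preserving_system M [T1, T2, T3] \<and>
    commuting_system M [T1, T2, T3] \<and>
    ergodic_system M [T1, T2, T3] \<and>
    (\<forall>l :: real. l > 0 \<longrightarrow>
      (\<exists>A\<in>sets M. \<forall>n :: int. n \<noteq> 0 \<longrightarrow>
        measure M (A \<inter> pre_image M (int_iterate M T1 n) A
                     \<inter> pre_image M (int_iterate M T2 n) A
                     \<inter> pre_image M (int_iterate M T3 n) A)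
          < measure M A powr l))"
proof -
  obtain g :: "(int \<Rightarrow> real \<times> real) \<Rightarrow> real" where g: "inj g"
    using ex_inj_sequences_to_real by blast
  \<comment> \<open>The system lives on sequences; only its cardinality decides whether it can be realised on
      \<open>\<real>\<^sup>3\<close>, and already one real coordinate has room for it.\<close>
  define f where "f \<omega> = (g \<omega>, 0 :: real, 0 :: real)" for \<omega>
  have f: "inj f" using g by (simp add: f_def inj_def)
  show ?thesis
    unfolding small_recurrence_def[symmetric]
    using measure_preserving_system_conjugate[OF f measure_preserving_torus_sequences]
      commuting_system_conjugate[OF f commuting_torus_sequences]
      ergodic_system_conjugate[OF f ergodic_torus_sequences]
      small_recurrence_conjugate[OF f measure_preserving_torus_sequences
        small_recurrence_torus_sequences]
    by (intro exI[of _ "embed_measure torus_sequences f"] exI[of _ "conjugate f (shift 1)"]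
        exI[of _ "conjugate f (shear 1)"] exI[of _ "conjugate f (shear 2)"]) simp
qed

end
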